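(* Let $H$ be a bounded hoop algebra, $F$ a filter of $H$, and $s:H\to H$ a square root on $H$. If $s(x)\odot s(y)=s(x\odot y)$ for every $x,y\in H$, then there is an isomorphism of hoop algebras $$s_F\left(\frac{H}{F}\right)\cong\frac{s(H)}{s(F)}.$$
   Context: A hoop algebra is an algebra $(H;\odot,\rightarrow,1)$ of type $(2,2,0)$ such that $(H;\odot,1)$ is a commutative monoid and, for all $x,y,z\in H$: $x\rightarrow x=1$; $x\odot(x\rightarrow y)=y\odot(y\rightarrow x)$; $(x\odot y)\rightarrow z=x\rightarrow(y\rightarrow z)$. It is partially ordered by $x\le y$ iff $x\rightarrow y=1$. $H$ is bounded if it has a least element $0$. A square root on $H$ is a map $s:H\to H$ such that (1) $s(x)\odot s(x)=x$ for every $x\in H$; (2) for all $x,y\in H$, if $y\odot y\le x$ then $y\le s(x)$. A filter of $H$ is a subset $F\subseteq H$ with $1\in F$, closed under $\odot$, and upward closed. A filter $F$ induces a congruence $x\equiv_F y$ iff $x\rightarrow y\in F$ and $y\rightarrow x\in F$; the class of $x$ is denoted $\frac{x}{F}$, and the set of classes $\frac{H}{F}$ is a hoop algebra under the induced operations. The map $s_F:\frac{H}{F}\to\frac{H}{F}$ is $s_F\left(\frac{x}{F}\right)=\frac{s(x)}{F}$; it is well defined and is a square root on $\frac{H}{F}$. The symbols $s_F(\frac{H}{F})$, $s(H)$, $s(F)$ denote images. Under the hypothesis of the claim, $s(H)$ is a subalgebra of $H$ (contains $1$, closed under $\odot$ and $\rightarrow$), $s(F)$ is a filter of $s(H)$,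 and $s_F(\frac{H}{F})$ is a subalgebra of $\frac{H}{F}$; the two sides of the isomorphism carry the resulting hoop structures. *)

theory Defs
  imports "HOL-Algebra.Group"
begin

section \<open>Hoop algebras\<close>

record 'a hoop = "'a monoid" +
  himp :: "['a, 'a] \<Rightarrow> 'a" (infixr "\<leadsto>\<index>" 65)

locale hoop = comm_monoid H for H (structure) +
  assumes imp_closed [intro, simp]:
      "\<lbrakk> x \<in> carrier H; y \<in> carrier H \<rbrakk> \<Longrightarrow> x \<leadsto> y \<in> carrier H"
    and imp_refl [simp]: "x \<in> carrier H \<Longrightarrow> x \<leadsto> x = \<one>"
    and mult_imp_comm:
      "\<lbrakk> x \<in> carrier H; y \<in> carrier H \<rbrakk> \<Longrightarrow> x \<otimes> (x \<leadsto> y) = y \<otimes> (y \<leadsto> x)"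
    and imp_curry:
      "\<lbrakk> x \<in> carrier H; y \<in> carrier H; z \<in> carrier H \<rbrakk>
        \<Longrightarrow> (x \<otimes> y) \<leadsto> z = x \<leadsto> (y \<leadsto> z)"

definition hoop_le :: "('a, 'm) hoop_scheme \<Rightarrow> 'a \<Rightarrow> 'a \<Rightarrow> bool" (infix "\<preceq>\<index>" 50)
  where "x \<preceq>\<^bsub>H\<^esub> y \<longleftrightarrow> x \<leadsto>\<^bsub>H\<^esub> y = \<one>\<^bsub>H\<^esub>"

locale bounded_hoop = hoop +
  assumes ex_least: "\<exists>z\<in>carrier H. \<forall>x\<in>carrier H. z \<preceq> x"

locale hoop_square_root = hoop +
  fixes s :: "'a \<Rightarrow> 'a"
  assumes root_closed [intro, simp]: "x \<in> carrier H \<Longrightarrow> s x \<in> carrier H"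
    and root_mult [simp]: "x \<in> carrier H \<Longrightarrow> s x \<otimes> s x = x"
    and root_greatest:
      "\<lbrakk> x \<in> carrier H; y \<in> carrier H; y \<otimes> y \<preceq> x \<rbrakk> \<Longrightarrow> y \<preceq> s x"

locale hoop_filter = hoop +
  fixes F :: "'a set"
  assumes filter_subset: "F \<subseteq> carrier H"
    and filter_one [intro, simp]: "\<one> \<in> F"
    and filter_mult [intro]: "\<lbrakk> x \<in> F; y \<in> F \<rbrakk> \<Longrightarrow> x \<otimes> y \<in> F"
    and filter_upward: "\<lbrakk> x \<in> F; y \<in> carrier H; x \<preceq> y \<rbrakk> \<Longrightarrow> y \<in> F"

section \<open>Quotients by filters\<close>

definition filter_rel :: "('a, 'm) hoop_scheme \<Rightarrow> 'a set \<Rightarrow> ('a \<times> 'a) set"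
  where "filter_rel H F =
    {(x, y). x \<in> carrier H \<and> y \<in> carrier H \<and> x \<leadsto>\<^bsub>H\<^esub> y \<in> F \<and> y \<leadsto>\<^bsub>H\<^esub> x \<in> F}"

definition filter_class :: "('a, 'm) hoop_scheme \<Rightarrow> 'a set \<Rightarrow> 'a \<Rightarrow> 'a set"
  where "filter_class H F x = filter_rel H F `` {x}"

text \<open>
  An operation on classes is the union, over all representatives, of the classes of the results.
  The lemmas \<open>quotient_mult\<close>, \<open>quotient_imp\<close> and \<open>root_quotient_class\<close> below show
  that this is the usual induced operation.
\<close>

definition hoop_quotient :: "('a, 'm) hoop_scheme \<Rightarrow> 'a set \<Rightarrow> 'a set hoop"
  where "hoop_quotient H F =
    \<lparr> carrier = carrier H // filter_rel H F,
      mult = (\<lambda>A B. \<Union>x\<in>A. \<Union>y\<in>B. filter_class H F (x \<otimes>\<^bsub>H\<^esub> y)),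
      one = filter_class H F \<one>\<^bsub>H\<^esub>,
      himp = (\<lambda>A B. \<Union>x\<in>A. \<Union>y\<in>B. filter_class H F (x \<leadsto>\<^bsub>H\<^esub> y)) \<rparr>"

definition root_quotient ::
    "('a, 'm) hoop_scheme \<Rightarrow> 'a set \<Rightarrow> ('a \<Rightarrow> 'a) \<Rightarrow> 'a set \<Rightarrow> 'a set"
  where "root_quotient H F s A = (\<Union>x\<in>A. filter_class H F (s x))"

section \<open>Subalgebras and isomorphisms\<close>

definition restrict_hoop :: "('a, 'm) hoop_scheme \<Rightarrow> 'a set \<Rightarrow> ('a, 'm) hoop_scheme"
  where "restrict_hoop H S = H\<lparr>carrier := S\<rparr>"

definition hoop_iso ::
    "('a, 'm) hoop_scheme \<Rightarrow> ('b, 'n) hoop_scheme \<Rightarrow> ('a \<Rightarrow> 'b) set"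
  where "hoop_iso A B =
    {f \<in> iso A B. f \<one>\<^bsub>A\<^esub> = \<one>\<^bsub>B\<^esub> \<and>
      (\<forall>x\<in>carrier A. \<forall>y\<in>carrier A. f (x \<leadsto>\<^bsub>A\<^esub> y) = f x \<leadsto>\<^bsub>B\<^esub> f y)}"

definition hoop_isomorphic ::
    "('a, 'm) hoop_scheme \<Rightarrow> ('b, 'n) hoop_scheme \<Rightarrow> bool" (infix "\<cong>\<^sub>h" 60)
  where "A \<cong>\<^sub>h B \<longleftrightarrow> hoop A \<and> hoop B \<and> hoop_iso A B \<noteq> {}"

section \<open>The induced operations are well defined\<close>

context hoop
begin

lemma le_antisym:
  assumes "x \<in> carrier H" "y \<in> carrier H" "x \<preceq> y" "y \<preceq> x"
  shows "x = y"
  using assms mult_imp_comm[of x y] by (simp add: hoop_le_def)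

lemma imp_imp_one:
  "\<lbrakk> x \<in> carrier H; y \<in> carrier H \<rbrakk> \<Longrightarrow> x \<leadsto> (\<one> \<leadsto> y) = x \<leadsto> y"
  using imp_curry[of x \<one> y] by simp

lemma one_imp [simp]: "y \<in> carrier H \<Longrightarrow> \<one> \<leadsto> y = y"
  using imp_imp_one[of y y] imp_imp_one[of "\<one> \<leadsto> y" y]
  by (intro le_antisym) (auto simp: hoop_le_def)

lemma imp_one [simp]:
  assumes "x \<in> carrier H"
  shows "x \<leadsto> \<one> = \<one>"
proof -
  have "x \<otimes> (x \<leadsto> \<one>) = x"
    using mult_imp_comm[of x \<one>] assms by simp
  then have "x \<leadsto> \<one> = ((x \<leadsto> \<one>) \<otimes> x) \<leadsto> \<one>"
    using assms by (simp add: m_comm)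
  then show ?thesis
    using assms by (simp add: imp_curry)
qed

lemma le_refl [simp]: "x \<in> carrier H \<Longrightarrow> x \<preceq> x"
  by (simp add: hoop_le_def)

lemma residuation:
  "\<lbrakk> x \<in> carrier H; y \<in> carrier H; z \<in> carrier H \<rbrakk>
    \<Longrightarrow> x \<otimes> y \<preceq> z \<longleftrightarrow> x \<preceq> y \<leadsto> z"
  by (simp add: hoop_le_def imp_curry)

lemma mult_le:
  "\<lbrakk> x \<in> carrier H; y \<in> carrier H \<rbrakk> \<Longrightarrow> x \<otimes> y \<preceq> x"
  using m_comm[of x y] imp_curry[of y x x] by (simp add: hoop_le_def)

lemma le_trans:
  assumes "x \<in> carrier H" "y \<in> carrier H" "z \<in> carrier H" "x \<preceq> y" "y \<preceq> z"
  shows "x \<preceq> z"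
proof -
  have "x = (y \<leadsto> x) \<otimes> y"
    using assms mult_imp_comm[of x y] by (simp add: hoop_le_def m_comm)
  then have "x \<leadsto> z = (y \<leadsto> x) \<leadsto> (y \<leadsto> z)"
    using assms by (metis imp_curry imp_closed)
  then show ?thesis
    using assms by (simp add: hoop_le_def)
qed

lemma mult_mono:
  assumes "x \<in> carrier H" "y \<in> carrier H" "u \<in> carrier H" "v \<in> carrier H"
    and "x \<preceq> u" "y \<preceq> v"
  shows "x \<otimes> y \<preceq> u \<otimes> v"
proof -
  have mono: "a \<otimes> c \<preceq> b \<otimes> c"
    if "a \<in> carrier H" "b \<in> carrier H" "c \<in> carrier H" "a \<preceq> b" for a b c
    using that le_trans[of a b "c \<leadsto> b \<otimes> c"] residuation[of b c "b \<otimes> c"]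
    by (simp add: residuation)
  have "x \<otimes> y \<preceq> u \<otimes> y" "u \<otimes> y \<preceq> u \<otimes> v"
    using mono[of x u y] mono[of y v u] assms by (simp_all add: m_comm)
  then show ?thesis
    using assms le_trans[of "x \<otimes> y" "u \<otimes> y" "u \<otimes> v"] by simp
qed

lemma mult_imp_le:
  "\<lbrakk> x \<in> carrier H; y \<in> carrier H \<rbrakk> \<Longrightarrow> x \<otimes> (x \<leadsto> y) \<preceq> y"
  using mult_le[of y "y \<leadsto> x"] by (simp add: mult_imp_comm)

lemma imp_mult_mono:
  assumes "x \<in> carrier H" "y \<in> carrier H" "u \<in> carrier H" "v \<in> carrier H"
  shows "(x \<leadsto> u) \<otimes> (y \<leadsto> v) \<preceq> (x \<otimes> y) \<leadsto> (u \<otimes> v)"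
proof -
  have "(x \<otimes> (x \<leadsto> u)) \<otimes> (y \<otimes> (y \<leadsto> v)) \<preceq> u \<otimes> v"
    using assms by (intro mult_mono mult_imp_le) auto
  moreover have "(x \<otimes> (x \<leadsto> u)) \<otimes> (y \<otimes> (y \<leadsto> v))
      = ((x \<leadsto> u) \<otimes> (y \<leadsto> v)) \<otimes> (x \<otimes> y)"
    using assms by (simp add: m_ac)
  ultimately show ?thesis
    using assms by (simp add: residuation)
qed

lemma imp_imp_mono:
  assumes "x \<in> carrier H" "y \<in> carrier H" "u \<in> carrier H" "v \<in> carrier H"
  shows "(u \<leadsto> x) \<otimes> (y \<leadsto> v) \<preceq> (x \<leadsto> y) \<leadsto> (u \<leadsto> v)"
proof -
  have "(u \<otimes> (u \<leadsto> x)) \<otimes> (x \<leadsto> y) \<preceq> x \<otimes> (x \<leadsto> y)"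
    using assms by (intro mult_mono mult_imp_le) auto
  then have "(u \<otimes> (u \<leadsto> x)) \<otimes> (x \<leadsto> y) \<preceq> y"
    using assms le_trans[OF _ _ _ _ mult_imp_le[of x y]] by simp
  then have "((u \<otimes> (u \<leadsto> x)) \<otimes> (x \<leadsto> y)) \<otimes> (y \<leadsto> v) \<preceq> y \<otimes> (y \<leadsto> v)"
    using assms by (intro mult_mono) auto
  then have "((u \<otimes> (u \<leadsto> x)) \<otimes> (x \<leadsto> y)) \<otimes> (y \<leadsto> v) \<preceq> v"
    using assms le_trans[OF _ _ _ _ mult_imp_le[of y v]] by simp
  moreover have "((u \<otimes> (u \<leadsto> x)) \<otimes> (x \<leadsto> y)) \<otimes> (y \<leadsto> v)
      = (((u \<leadsto> x) \<otimes> (y \<leadsto> v)) \<otimes> (x \<leadsto> y)) \<otimes> u"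
    using assms by (simp add: m_ac)
  ultimately show ?thesis
    using assms by (simp add: residuation)
qed

lemma imp_trans:
  assumes "x \<in> carrier H" "y \<in> carrier H" "z \<in> carrier H"
  shows "(x \<leadsto> y) \<otimes> (y \<leadsto> z) \<preceq> x \<leadsto> z"
  using imp_imp_mono[of y y x z] assms by simp

end

context hoop_filter
begin

lemma equiv_filter_rel: "equiv (carrier H) (filter_rel H F)"
proof (intro equivI)
  show "trans (filter_rel H F)"
  proof (rule transI)
    fix x y z
    assume xy: "(x, y) \<in> filter_rel H F" and yz: "(y, z) \<in> filter_rel H F"
    have "(x \<leadsto> y) \<otimes> (y \<leadsto> z) \<in> F" "(z \<leadsto> y) \<otimes> (y \<leadsto> x) \<in> F"
      using xy yz by (auto simp: filter_rel_def)
    then show "(x, z) \<in> filter_rel H F"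
      using xy yz filter_upward[OF _ _ imp_trans[of x y z]] filter_upward[OF _ _ imp_trans[of z y x]]
      by (auto simp: filter_rel_def)
  qed
qed (auto simp: filter_rel_def refl_on_def sym_def)

lemma filter_class_eq_iff:
  "\<lbrakk> x \<in> carrier H; y \<in> carrier H \<rbrakk>
    \<Longrightarrow> filter_class H F x = filter_class H F y \<longleftrightarrow> (x, y) \<in> filter_rel H F"
  unfolding filter_class_def using eq_equiv_class_iff[OF equiv_filter_rel] by blast

lemma mult_congruent:
  assumes "(x, u) \<in> filter_rel H F" "(y, v) \<in> filter_rel H F"
  shows "(x \<otimes> y, u \<otimes> v) \<in> filter_rel H F"
proof -
  have "(x \<leadsto> u) \<otimes> (y \<leadsto> v) \<in> F" "(u \<leadsto> x) \<otimes> (v \<leadsto> y) \<in> F"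
    using assms by (auto simp: filter_rel_def)
  then show ?thesis
    using assms filter_upward[OF _ _ imp_mult_mono[of x y u v]]
      filter_upward[OF _ _ imp_mult_mono[of u v x y]]
    by (auto simp: filter_rel_def)
qed

lemma imp_congruent:
  assumes "(x, u) \<in> filter_rel H F" "(y, v) \<in> filter_rel H F"
  shows "(x \<leadsto> y, u \<leadsto> v) \<in> filter_rel H F"
proof -
  have "(u \<leadsto> x) \<otimes> (y \<leadsto> v) \<in> F" "(x \<leadsto> u) \<otimes> (v \<leadsto> y) \<in> F"
    using assms by (auto simp: filter_rel_def)
  then show ?thesis
    using assms filter_upward[OF _ _ imp_imp_mono[of x y u v]]
      filter_upward[OF _ _ imp_imp_mono[of u v x y]]
    by (auto simp: filter_rel_def)
qed

lemma quotient_mult: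
  assumes "x \<in> carrier H" "y \<in> carrier H"
  shows "filter_class H F x \<otimes>\<^bsub>hoop_quotient H F\<^esub> filter_class H F y = filter_class H F (x \<otimes> y)"
proof -
  have "congruent2 (filter_rel H F) (filter_rel H F) (\<lambda>x y. filter_class H F (x \<otimes> y))"
    by (rule congruent2I')
      (metis equiv_class_eq[OF equiv_filter_rel] filter_class_def mult_congruent)
  from UN_equiv_class2[OF equiv_filter_rel equiv_filter_rel this assms]
  show ?thesis by (simp add: hoop_quotient_def filter_class_def)
qed

lemma quotient_imp:
  assumes "x \<in> carrier H" "y \<in> carrier H"
  shows "filter_class H F x \<leadsto>\<^bsub>hoop_quotient H F\<^esub> filter_class H F y = filter_class H F (x \<leadsto> y)"
proof -
  have "congruent2 (filter_rel H F) (filter_rel H F) (\<lambda>x y. filter_class H F (x \<leadsto> y))"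
    by (rule congruent2I')
      (metis equiv_class_eq[OF equiv_filter_rel] filter_class_def imp_congruent)
  from UN_equiv_class2[OF equiv_filter_rel equiv_filter_rel this assms]
  show ?thesis by (simp add: hoop_quotient_def filter_class_def)
qed

end

context hoop_square_root
begin

lemma root_imp_le:
  assumes "x \<in> carrier H" "y \<in> carrier H"
  shows "s x \<leadsto> s y \<preceq> s (x \<leadsto> y)"
proof -
  have "(s x \<leadsto> s y) \<otimes> (s x \<leadsto> s y) \<preceq> (s x \<otimes> s x) \<leadsto> (s y \<otimes> s y)"
    using assms by (intro imp_mult_mono) auto
  then show ?thesis
    using assms by (intro root_greatest) auto
qed

lemma root_mono:
  assumes "x \<in> carrier H" "y \<in> carrier H" "x \<preceq> y"
  shows "s x \<preceq> s y"
  using assms by (intro root_greatest) auto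

text \<open>
  The hypothesis of multiplicativity makes \<open>s\<close> a homomorphism for \<open>\<leadsto>\<close> as well, so that
  \<open>s ` carrier H\<close> is closed under both operations.
\<close>

lemma root_imp:
  assumes mult: "\<And>x y. \<lbrakk> x \<in> carrier H; y \<in> carrier H \<rbrakk> \<Longrightarrow> s x \<otimes> s y = s (x \<otimes> y)"
    and x: "x \<in> carrier H" and y: "y \<in> carrier H"
  shows "s (x \<leadsto> y) = s x \<leadsto> s y"
proof (rule le_antisym)
  have "s (x \<leadsto> y) \<otimes> s x \<preceq> s y"
    using x y mult[of "x \<leadsto> y" x] mult_imp_le[of x y] by (simp add: m_comm root_mono)
  then show "s (x \<leadsto> y) \<preceq> s x \<leadsto> s y"
    using x y by (simp add: residuation)
qed (use x y root_imp_le in auto)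

lemma root_quotient_class:
  assumes mult: "\<And>x y. \<lbrakk> x \<in> carrier H; y \<in> carrier H \<rbrakk> \<Longrightarrow> s x \<otimes> s y = s (x \<otimes> y)"
    and F: "hoop_filter H F" and x: "x \<in> carrier H"
  shows "root_quotient H F s (filter_class H F x) = filter_class H F (s x)"
proof -
  interpret hoop_filter H F by (fact F)
  have in_F: "s a \<in> F" if "a \<in> F" for a
  proof -
    have a: "a \<in> carrier H"
      using that filter_subset by auto
    show ?thesis
      using a by (intro filter_upward[OF that] root_greatest mult_le) auto
  qed
  have "(s a, s b) \<in> filter_rel H F" if ab: "(a, b) \<in> filter_rel H F" for a b
  proof -
    have carr: "a \<in> carrier H" "b \<in> carrier H"
      using ab by (auto simp: filter_rel_def)
    have "s (a \<leadsto> b) \<in> F" "s (b \<leadsto> a) \<in> F"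
      using ab in_F by (auto simp: filter_rel_def)
    then show ?thesis
      using carr root_imp[OF mult carr] root_imp[OF mult carr(2) carr(1)]
      by (simp add: filter_rel_def)
  qed
  then have "congruent (filter_rel H F) (\<lambda>a. filter_class H F (s a))"
    unfolding congruent_def filter_class_def
    using equiv_class_eq[OF equiv_filter_rel] by blast
  from UN_equiv_class[OF equiv_filter_rel this x] show ?thesis
    by (simp add: root_quotient_def filter_class_def)
qed

end

end

(*
  Since s x * s x = x, a filter F satisfies: a is in F iff s a is in F. Hence s F is the trace of F on
  the subalgebra s H, and the claim is an instance of the second isomorphism theorem for hoops:
  for a subalgebra S of H, the image of S in H/F is isomorphic to S/(F Int S), by intersecting each
  class with S.
*)
theory Submission
  imports Defs
begin

lemma restrict_hoop_simps [simp]: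
  "carrier (restrict_hoop H S) = S"
  "mult (restrict_hoop H S) = mult H"
  "one (restrict_hoop H S) = one H"
  "himp (restrict_hoop H S) = himp H"
  by (simp_all add: restrict_hoop_def)

locale subhoop = hoop +
  fixes S :: "'a set"
  assumes sub_subset: "S \<subseteq> carrier H"
    and sub_one: "\<one> \<in> S"
    and sub_mult: "\<lbrakk> x \<in> S; y \<in> S \<rbrakk> \<Longrightarrow> x \<otimes> y \<in> S"
    and sub_imp: "\<lbrakk> x \<in> S; y \<in> S \<rbrakk> \<Longrightarrow> x \<leadsto> y \<in> S"
begin

lemma sub_carrier: "x \<in> S \<Longrightarrow> x \<in> carrier H"
  using sub_subset by blast

lemma hoop_restrict: "hoop (restrict_hoop H S)"
  by unfold_locales
    (auto simp: sub_carrier sub_one sub_mult sub_imp m_assoc imp_curry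
      intro: m_comm mult_imp_comm)

end

context hoop_filter
begin

lemma quotient_carrier: "carrier (hoop_quotient H F) = filter_class H F ` carrier H"
  by (auto simp: hoop_quotient_def quotient_def filter_class_def)

lemma quotient_one: "\<one>\<^bsub>hoop_quotient H F\<^esub> = filter_class H F \<one>"
  by (simp add: hoop_quotient_def)

text \<open>All hoop axioms are equations, so each passes from representatives to their classes
  through \<open>quotient_mult\<close> and \<open>quotient_imp\<close>.\<close>

lemma hoop_quotient: "hoop (hoop_quotient H F)"
  by unfold_locales
    (auto simp: quotient_carrier quotient_one quotient_mult quotient_imp m_ac imp_curry
      mult_imp_comm)

lemma subhoop_class_image:
  assumes "subhoop H S"
  shows "subhoop (hoop_quotient H F) (filter_class H F ` S)"
proof -
  interpret S: subhoop H S by (fact assms)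
  interpret Q: hoop "hoop_quotient H F" by (fact hoop_quotient)
  show ?thesis
    by unfold_locales
      (auto simp: quotient_carrier quotient_one quotient_mult quotient_imp
        S.sub_carrier S.sub_one S.sub_mult S.sub_imp)
qed

text \<open>The subalgebra has the same \<open>\<leadsto>\<close> and unit as \<open>H\<close>, so
  its order is the restricted one and upward closure is inherited from \<open>F\<close>.\<close>

lemma hoop_filter_trace:
  assumes "subhoop H S"
  shows "hoop_filter (restrict_hoop H S) (F \<inter> S)"
proof -
  interpret S: subhoop H S by (fact assms)
  interpret R: hoop "restrict_hoop H S" by (fact S.hoop_restrict)
  have "y \<in> F" if "x \<in> F" "y \<in> S" "x \<leadsto> y = \<one>" for x y
    using that filter_upward[of x y] by (simp add: hoop_le_def S.sub_carrier)
  then show ?thesis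
    by unfold_locales (auto simp: S.sub_one S.sub_mult hoop_le_def)
qed

text \<open>For y in S both implications between x and y lie in S by closure, so for them membership
  in F and in \<open>F \<inter> S\<close> agree.\<close>

lemma filter_class_trace:
  assumes "subhoop H S" "x \<in> S"
  shows "filter_class (restrict_hoop H S) (F \<inter> S) x = filter_class H F x \<inter> S"
proof -
  interpret S: subhoop H S by (fact assms(1))
  show ?thesis
    using assms(2) by (auto simp: filter_class_def filter_rel_def S.sub_carrier S.sub_imp)
qed

theorem second_isomorphism:
  assumes "subhoop H S"
  shows "restrict_hoop (hoop_quotient H F) (filter_class H F ` S)
    \<cong>\<^sub>h hoop_quotient (restrict_hoop H S) (F \<inter> S)"
proof -
  interpret S: subhoop H S by (fact assms)
  interpret Q: subhoop "hoop_quotient H F" "filter_class H F ` S"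
    by (rule subhoop_class_image[OF assms])
  interpret T: hoop_filter "restrict_hoop H S" "F \<inter> S"
    by (rule hoop_filter_trace[OF assms])
  let ?A = "restrict_hoop (hoop_quotient H F) (filter_class H F ` S)"
  let ?B = "hoop_quotient (restrict_hoop H S) (F \<inter> S)"
  let ?f = "\<lambda>A. A \<inter> S"
  \<comment> \<open>Read from right to left, the equation evaluates \<open>?f\<close> at the class
    of any x in S as the class of x in the quotient of S. The homomorphism laws then reduce to
    computing with representatives chosen in S.\<close>
  note trace = filter_class_trace[OF assms, symmetric]
  have inj: "inj_on ?f (filter_class H F ` S)"
  proof (rule inj_onI, elim imageE, hypsubst)
    fix x y
    assume xy: "x \<in> S" "y \<in> S" and "filter_class H F x \<inter> S = filter_class H F y \<inter> S"
    \<comment> \<open>Equal traces are equal classes in the quotient of S, and congruence modulo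
      \<open>F \<inter> S\<close> implies congruence modulo F.\<close>
    then have "(x, y) \<in> filter_rel (restrict_hoop H S) (F \<inter> S)"
      by (simp add: trace T.filter_class_eq_iff)
    then have "(x, y) \<in> filter_rel H F"
      using xy by (simp add: filter_rel_def S.sub_carrier)
    then show "filter_class H F x = filter_class H F y"
      using xy by (simp add: filter_class_eq_iff S.sub_carrier)
  qed
  have "?f ` filter_class H F ` S = carrier ?B"
    by (simp add: T.quotient_carrier image_image trace)
  with inj have "bij_betw ?f (carrier ?A) (carrier ?B)"
    by (simp add: bij_betw_def)
  moreover have "?f \<in> hom ?A ?B"
    by (auto simp: hom_def quotient_mult T.quotient_mult T.quotient_carrier trace
      S.sub_carrier S.sub_mult)
  moreover have "?f \<one>\<^bsub>?A\<^esub> = \<one>\<^bsub>?B\<^esub>"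
    by (simp add: quotient_one T.quotient_one trace S.sub_one)
  moreover have "?f (x \<leadsto>\<^bsub>?A\<^esub> y) = ?f x \<leadsto>\<^bsub>?B\<^esub> ?f y"
    if "x \<in> carrier ?A" "y \<in> carrier ?A" for x y
  proof -
    from that obtain a b
      where "a \<in> S" "b \<in> S" "x = filter_class H F a" "y = filter_class H F b"
      by auto
    then show ?thesis
      by (simp add: quotient_imp T.quotient_imp trace S.sub_carrier S.sub_imp)
  qed
  ultimately have "?f \<in> hoop_iso ?A ?B"
    by (simp add: hoop_iso_def iso_def)
  then show ?thesis
    using Q.hoop_restrict T.hoop_quotient by (auto simp: hoop_isomorphic_def)
qed

end

context hoop_square_root
begin

text \<open>Maximality of the root gives 1 \<le> s 1, and 1 is the top element.\<close>

lemma root_one: "s \<one> = \<one>"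
  using root_greatest[of \<one> \<one>] by (simp add: hoop_le_def)

text \<open>Multiplicativity gives closure under the product directly, and closure under
  \<open>\<leadsto>\<close> through \<open>root_imp\<close>.\<close>

lemma subhoop_root_image:
  assumes "\<And>x y. \<lbrakk> x \<in> carrier H; y \<in> carrier H \<rbrakk> \<Longrightarrow> s x \<otimes> s y = s (x \<otimes> y)"
  shows "subhoop H (s ` carrier H)"
proof
  show "\<one> \<in> s ` carrier H"
    using root_one by (metis image_eqI one_closed)
qed (auto simp: assms root_imp[OF assms, symmetric])

text \<open>For a in F, a * a \<le> a yields a \<le> s a, so s a is in F by upward closure.
  Conversely, if s a is in F, then so is its square a.\<close>

lemma root_image_filter:
  assumes "hoop_filter H F"
  shows "s ` F = F \<inter> s ` carrier H"
proof -
  interpret hoop_filter H F by (fact assms)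
  have carr: "a \<in> carrier H" if "a \<in> F" for a
    using that filter_subset by blast
  have "s a \<in> F" if "a \<in> F" for a
    using carr[OF that] by (intro filter_upward[OF that] root_greatest mult_le) auto
  moreover have "a \<in> F" if "s a \<in> F" "a \<in> carrier H" for a
    using filter_mult[OF that(1) that(1)] that(2) by simp
  ultimately show ?thesis
    using carr by blast
qed

end

theorem theorem4p5:
  fixes H (structure) and F :: "'a set" and s :: "'a \<Rightarrow> 'a"
  assumes "bounded_hoop H"
    and "hoop_filter H F"
    and "hoop_square_root H s"
    and "\<And>x y. \<lbrakk> x \<in> carrier H; y \<in> carrier H \<rbrakk> \<Longrightarrow> s x \<otimes> s y = s (x \<otimes> y)"
  shows "restrict_hoop (hoop_quotient H F) (root_quotient H F s ` carrier (hoop_quotient H F))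
    \<cong>\<^sub>h hoop_quotient (restrict_hoop H (s ` carrier H)) (s ` F)"
proof -
  interpret F: hoop_filter H F by (fact assms(2))
  interpret s: hoop_square_root H s by (fact assms(3))
  \<comment> \<open>The image of the induced root consists of the classes of the elements of s H, so
    the claim becomes \<open>second_isomorphism\<close> with S = s H.\<close>
  have "root_quotient H F s ` carrier (hoop_quotient H F) = filter_class H F ` s ` carrier H"
    by (simp add: F.quotient_carrier image_image s.root_quotient_class[OF assms(4,2)])
  then show ?thesis
    using F.second_isomorphism[OF s.subhoop_root_image[OF assms(4)]]
    by (simp add: s.root_image_filter[OF assms(2)])
qed

end
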